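(* Let $f_1,\dots,f_s\in\mathbb{F}_q\langle X^q\rangle$ have $q$-degrees $d_1,\dots,d_s$, let $n=\sum_i d_i$, and assume that each $f_i$ is coprime with the least left common multiple $b_i$ of the $f_j$, $j\ne i$. Let $k<n$ be a positive integer and $\alpha\ge0$ an integer with $k+\alpha<n$. Let $r\in\{1,\dots,\min(m,n-\alpha-k)\}$. Suppose that $e$ is uniformly distributed on $\mathbb{F}_{q^m}^n$ and let $E=\Phi(e)$, with upper part $\overline{E}$. Then, conditionally on $w_r(E)=r$, the equality $\overline{\mathcal{E}}=\mathcal{E}$ of the supports of $\overline{E}$ and $E$ holds with probability $$q^{r(k+\alpha)}\prod_{i=0}^{r-1}\frac{q^{n-(k+\alpha)}-q^i}{q^n-q^i}.$$
   Context: Let $q$ be a prime power and $m\ge1$. $\mathbb{F}_{q^m}\langle X^q\rangle$ is the set of linearized polynomials $\sum_{i=0}^d p_iX^{q^i}$, $p_i\in\mathbb{F}_{q^m}$, a non-commutative ring under addition and composition $\circ$, determined by $(aX^{q^i})\circ(bX^{q^j})=ab^{q^i}X^{q^{i+j}}$, with unit $X$; $\mathbb{F}_q\langle X^q\rangle$ is the subset with coefficients in $\mathbb{F}_q$. The $q$-degree of a nonzero element is the largest $i$ such that the coefficient of $X^{q^i}$ is nonzero; $\mathbb{F}_{q^m}\langle X^q\rangle_t$ is the set of elements of $q$-degree $<t$ (including $0$). Coprime means that the greatest right common divisor is $X$ (up to scalar); the least left common multiple is a generator of the intersection of the left ideals generated. $\Phi:\prod_{i=1}^s\mathbb{F}_{q^m}\langle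 X^q\rangle_{d_i}\to\mathbb{F}_{q^m}\langle X^q\rangle_n$ is the Chinese Remainder lifting: $\Phi(p_1,\dots,p_s)$ is the remainder of the right division of $\sum_{i}p_i\circ S_{1,i}\circ b_i$ by the least left common multiple of $f_1,\dots,f_s$, where $S_{1,i}\circ b_i+S_{2,i}\circ f_i=X$; it satisfies $\Phi(\pi_1(p),\dots,\pi_s(p))=p$ for all $p$ of $q$-degree $<n$, where $\pi_i(p)$ is the remainder of the right division of $p$ by $f_i$. A vector $e\in\mathbb{F}_{q^m}^n$ is identified with an element of $\prod_i\mathbb{F}_{q^m}\langle X^q\rangle_{d_i}$ via concatenated coefficient vectors. Write $E=\sum_{i=0}^{n-1}e_iX^{q^i}$. Its upper part is $\overline{E}=\sum_{i=k+\alpha}^{n-1}e_iX^{q^i}$. The support of a linearized polynomial is the $\mathbb{F}_q$-subspace of $\mathbb{F}_{q^m}$ spanned by its coefficients; $\mathcal{E}$ and $\overline{\mathcal{E}}$ are the supports of $E$ and $\overline{E}$. $w_r$ is the $\mathbb{F}_q$-dimension of the support. (In the paper $\alpha$ is the $q$-degree of the polynomial $A\in\mathbb{F}_{q^m}\langle X^q\rangle$ defining the code.) *)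

theory Defs
  imports
    "HOL-Probability.Probability"
    "HOL-Computational_Algebra.Polynomial"
    "HOL-Number_Theory.Prime_Powers"
begin

text \<open>
  The extension \<open>GF(q) \<subseteq> GF(q^m)\<close> is given by two finite field types \<open>'k\<close> (the small field) and \<open>'a\<close>
  (the large field) together with an embedding \<open>emb\<close>, so that spans and dimensions over the
  small field are those of the library, for the scalar multiplication \<open>\<lambda>c x. emb c * x\<close>.
\<close>

definition field_embedding :: "('k::field \<Rightarrow> 'a::field) \<Rightarrow> bool" where
  "field_embedding emb \<longleftrightarrow>
     emb 1 = 1 \<and> (\<forall>x y. emb (x + y) = emb x + emb y) \<and> (\<forall>x y. emb (x * y) = emb x * emb y)"

lemma vector_space_field_embedding:
  assumes "field_embedding emb"
  shows "vector_space (\<lambda>c x. emb c * x)"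
  using assms unfolding field_embedding_def
  by unfold_locales (simp_all add: algebra_simps)

text \<open>
  Linearized polynomials are the ordinary polynomials whose exponents are powers of \<open>q\<close>; the
  ring multiplication is \<^const>\<open>pcompose\<close>, written \<open>\<circ>\<^sub>p\<close>, with unit \<open>X\<close> = \<open>[:0, 1:]\<close>.
\<close>

definition lin_polys :: "nat \<Rightarrow> 'a::field poly set" where
  "lin_polys q = {p. \<forall>i. coeff p i \<noteq> 0 \<longrightarrow> (\<exists>j. i = q ^ j)}"

definition lin_coeff :: "nat \<Rightarrow> 'a::field poly \<Rightarrow> nat \<Rightarrow> 'a" where
  "lin_coeff q p i = coeff p (q ^ i)"

definition lin_polys_over :: "nat \<Rightarrow> ('k::field \<Rightarrow> 'a::field) \<Rightarrow> 'a poly set" where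
  "lin_polys_over q emb = {p \<in> lin_polys q. \<forall>i. lin_coeff q p i \<in> range emb}"

text \<open>Only meaningful for nonzero \<open>p\<close> and \<open>q \<ge> 2\<close>.\<close>

definition qdegree :: "nat \<Rightarrow> 'a::field poly \<Rightarrow> nat" where
  "qdegree q p = Max {i. lin_coeff q p i \<noteq> 0}"

definition lin_polys_less :: "nat \<Rightarrow> nat \<Rightarrow> 'a::field poly set" where
  "lin_polys_less q t = {p \<in> lin_polys q. p = 0 \<or> qdegree q p < t}"

definition left_ideal :: "nat \<Rightarrow> 'a::field poly \<Rightarrow> 'a poly set" where
  "left_ideal q f = {h \<circ>\<^sub>p f | h. h \<in> lin_polys q}"

definition right_divides :: "nat \<Rightarrow> 'a::field poly \<Rightarrow> 'a poly \<Rightarrow> bool" where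
  "right_divides q g f \<longleftrightarrow> (\<exists>h \<in> lin_polys q. f = h \<circ>\<^sub>p g)"

definition is_gcrd :: "nat \<Rightarrow> 'a::field poly \<Rightarrow> 'a poly \<Rightarrow> 'a poly \<Rightarrow> bool" where
  "is_gcrd q g f h \<longleftrightarrow>
     g \<in> lin_polys q \<and> right_divides q g f \<and> right_divides q g h \<and>
     (\<forall>c \<in> lin_polys q. right_divides q c f \<and> right_divides q c h \<longrightarrow> right_divides q c g)"

definition lin_coprime :: "nat \<Rightarrow> 'a::field poly \<Rightarrow> 'a poly \<Rightarrow> bool" where
  "lin_coprime q f h \<longleftrightarrow> is_gcrd q [:0, 1:] f h"

text \<open>
  A generator of the intersection of the left ideals is unique up to a nonzero scalar; one is
  chosen. The intersection with \<^term>\<open>lin_polys q\<close> matters for the empty family only, whose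
  least left common multiple is \<open>X\<close> up to a scalar.
\<close>

definition is_llcm :: "nat \<Rightarrow> 'a::field poly \<Rightarrow> 'a poly set \<Rightarrow> bool" where
  "is_llcm q g F \<longleftrightarrow>
     g \<in> lin_polys q \<and> left_ideal q g = lin_polys q \<inter> (\<Inter>f\<in>F. left_ideal q f)"

definition llcm :: "nat \<Rightarrow> 'a::field poly set \<Rightarrow> 'a poly" where
  "llcm q F = (SOME g. is_llcm q g F)"

definition right_rem :: "nat \<Rightarrow> 'a::field poly \<Rightarrow> 'a poly \<Rightarrow> 'a poly" where
  "right_rem q p g =
     (THE r. r \<in> lin_polys_less q (qdegree q g) \<and> (\<exists>h \<in> lin_polys q. p = h \<circ>\<^sub>p g + r))"

text \<open>The families \<open>f\<^sub>1, \<dots>, f\<^sub>s\<close> are indexed from \<open>0\<close>.\<close>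

definition other_llcm :: "nat \<Rightarrow> nat \<Rightarrow> (nat \<Rightarrow> 'a::field poly) \<Rightarrow> nat \<Rightarrow> 'a poly" where
  "other_llcm q s f i = llcm q (f ` ({..<s} - {i}))"

definition bezout_coeff :: "nat \<Rightarrow> 'a::field poly \<Rightarrow> 'a poly \<Rightarrow> 'a poly" where
  "bezout_coeff q b f =
     (SOME S1. S1 \<in> lin_polys q \<and> (\<exists>S2 \<in> lin_polys q. S1 \<circ>\<^sub>p b + S2 \<circ>\<^sub>p f = [:0, 1:]))"

text \<open>
  The Chinese Remainder lifting \<open>\<Phi>\<close>. Its value depends neither on the chosen Bezout
  coefficients nor on the chosen least left common multiples.
\<close>

definition crt_lift ::
    "nat \<Rightarrow> nat \<Rightarrow> (nat \<Rightarrow> 'a::field poly) \<Rightarrow> (nat \<Rightarrow> 'a poly) \<Rightarrow> 'a poly" where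
  "crt_lift q s f p =
     right_rem q
       (\<Sum>i<s. p i \<circ>\<^sub>p bezout_coeff q (other_llcm q s f i) (f i) \<circ>\<^sub>p other_llcm q s f i)
       (llcm q (f ` {..<s}))"

text \<open>Vectors of length \<open>n\<close> are the extensional functions on \<^term>\<open>{..<n}\<close>.\<close>

definition vectors :: "nat \<Rightarrow> (nat \<Rightarrow> 'a) set" where
  "vectors n = {..<n} \<rightarrow>\<^sub>E UNIV"

text \<open>
  The \<open>i\<close>-th component of the tuple whose concatenated coefficient vectors, with block lengths
  \<open>d 0, d 1, \<dots>\<close>, form the vector \<open>e\<close>.
\<close>

definition vector_block :: "nat \<Rightarrow> (nat \<Rightarrow> nat) \<Rightarrow> (nat \<Rightarrow> 'a::field) \<Rightarrow> nat \<Rightarrow> 'a poly" where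
  "vector_block q d e i = (\<Sum>j<d i. monom (e ((\<Sum>l<i. d l) + j)) (q ^ j))"

definition upper_part :: "nat \<Rightarrow> nat \<Rightarrow> nat \<Rightarrow> 'a::field poly \<Rightarrow> 'a poly" where
  "upper_part q t n p = (\<Sum>i\<in>{t..<n}. monom (lin_coeff q p i) (q ^ i))"

definition lin_support :: "nat \<Rightarrow> ('k::field \<Rightarrow> 'a::field) \<Rightarrow> 'a poly \<Rightarrow> 'a set" where
  "lin_support q emb p = module.span (\<lambda>c x. emb c * x) (range (lin_coeff q p))"

definition rank_weight :: "nat \<Rightarrow> ('k::field \<Rightarrow> 'a::field) \<Rightarrow> 'a poly \<Rightarrow> nat" where
  "rank_weight q emb p = vector_space.dim (\<lambda>c x. emb c * x) (lin_support q emb p)"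

end

theory Submission
  imports Defs
begin

text \<open>
  The lift \<open>\<Phi>(p)\<close> is congruent to \<open>p\<^sub>i\<close> modulo \<open>f\<^sub>i\<close> for every \<open>i\<close>, so \<open>\<Phi>\<close> is injective. A least left
  common multiple of the \<open>f\<^sub>i\<close> has \<open>q\<close>-degree at most \<open>n\<close>, so \<open>\<Phi>\<close> maps into the polynomials of
  \<open>q\<close>-degree less than \<open>n\<close>; comparing cardinalities, it is a bijection onto them. Hence the
  coefficient vector of \<open>E\<close> is again uniformly distributed. Let \<open>a\<^sub>N\<close> be the number of families of
  \<open>N\<close> vectors that span dimension \<open>r\<close>. Given the last \<open>N = n - (k + \<alpha>)\<close> coefficients, spanning
  dimension \<open>r\<close>, the first \<open>k + \<alpha>\<close> are arbitrary elements of their span, so the probability is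
  \<open>q\<^bsup>r(k + \<alpha>)\<^esup> a\<^sub>N / a\<^sub>n\<close>, and \<open>a\<^sub>N\<close> is \<open>\<Prod>i<r. (q\<^sup>N - q\<^sup>i)\<close> up to a factor independent of \<open>N\<close>.
\<close>

section \<open>Linearized polynomials\<close>

text \<open>For \<open>q\<close> a power of a prime characteristic, raising to the power
  \<open>q\<close> is additive, which makes composition of linearized polynomials distributive on
  both sides. The argument \<open>field_type\<close> fixes the coefficient field, which
  \<open>q\<close> does not determine.\<close>

locale linearized_polynomials =
  fixes q :: nat and field_type :: "'a::field itself"
  assumes prime_CHAR: "prime CHAR('a)" and q_CHAR_power: "\<exists>e>0. q = CHAR('a) ^ e"
begin

abbreviation lins :: "'a poly set" where "lins \<equiv> lin_polys q"

abbreviation lideal :: "'a poly \<Rightarrow> 'a poly set" where "lideal \<equiv> left_ideal q"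

lemma q_gt_1: "q > 1"
  using q_CHAR_power prime_gt_1_nat[OF prime_CHAR] by (metis one_less_power)

lemma q_power_eq_iff [simp]: "q ^ i = q ^ j \<longleftrightarrow> i = j"
  using q_gt_1 by simp

lemma q_pos [simp]: "q > 0"
  using q_gt_1 by simp

lemma q_power_pos: "q ^ i > 0"
  by simp

lemma add_power_q: "(x + y :: 'a poly) ^ (q ^ i) = x ^ (q ^ i) + y ^ (q ^ i)"
proof -
  obtain e where "q = CHAR('a) ^ e" using q_CHAR_power by blast
  then have "q ^ i = CHAR('a poly) ^ (e * i)" by (simp add: power_mult)
  with prime_CHAR show ?thesis by (intro freshmans_dream') auto
qed

lemma zero_lin [simp]: "0 \<in> lins" and X_lin [simp]: "[:0, 1:] \<in> lins"
  and monom_lin [simp]: "monom a (q ^ i) \<in> lins"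
  and add_lin: "p \<in> lins \<Longrightarrow> p' \<in> lins \<Longrightarrow> p + p' \<in> lins"
  and uminus_lin: "p \<in> lins \<Longrightarrow> - p \<in> lins"
  and smult_lin: "p \<in> lins \<Longrightarrow> smult a p \<in> lins"
proof -
  show "[:0, 1:] \<in> lins"
    unfolding lin_polys_def by (auto simp: coeff_pCons split: nat.splits intro: exI[of _ 0])
  show "p \<in> lins \<Longrightarrow> p' \<in> lins \<Longrightarrow> p + p' \<in> lins"
    unfolding lin_polys_def by auto (metis add.right_neutral)
qed (auto simp: lin_polys_def)

lemma diff_lin: "p \<in> lins \<Longrightarrow> p' \<in> lins \<Longrightarrow> p - p' \<in> lins"
  using add_lin[OF _ uminus_lin] by fastforce

lemma sum_lin: "(\<And>i. i \<in> A \<Longrightarrow> g i \<in> lins) \<Longrightarrow> sum g A \<in> lins"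
  by (induction A rule: infinite_finite_induct) (auto intro: add_lin)

lemma lin_poly_induct [consumes 1, case_names monom add]:
  assumes "p \<in> lins"
    and "\<And>a i. P (monom a (q ^ i))"
    and "\<And>p p'. p \<in> lins \<Longrightarrow> p' \<in> lins \<Longrightarrow> P p \<Longrightarrow> P p' \<Longrightarrow> P (p + p')"
  shows "P p"
proof -
  have summand: "monom (coeff p i) i \<in> lins \<and> P (monom (coeff p i) i)" for i
  proof (cases "coeff p i = 0")
    case True
    \<comment> \<open>The zero polynomial is the monomial \<open>monom 0 (q ^ 0)\<close>; this
      covers the exponents that are not powers of \<open>q\<close>.\<close>
    then show ?thesis using assms(2)[of 0 0] by simp
  next
    case False
    then obtain j where "i = q ^ j" using assms(1) unfolding lin_polys_def by blast
    then show ?thesis using assms(2) by simp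
  qed
  have "sum (\<lambda>i. monom (coeff p i) i) {..k} \<in> lins \<and> P (sum (\<lambda>i. monom (coeff p i) i) {..k})" for k
    by (induction k) (simp_all add: summand assms(3) add_lin)
  then show ?thesis by (metis poly_as_sum_of_monoms)
qed

lemma pcompose_monom: "monom a k \<circ>\<^sub>p g = smult a (g ^ k)" for g :: "'a poly"
  by (induction k) (simp_all add: monom_0 monom_Suc pcompose_pCons)

lemma power_lin: "p \<in> lins \<Longrightarrow> p ^ (q ^ i) \<in> lins"
  by (induction rule: lin_poly_induct)
     (auto simp: monom_power add_power_q simp flip: power_add intro: add_lin)

lemma pcompose_lin: "h \<in> lins \<Longrightarrow> g \<in> lins \<Longrightarrow> h \<circ>\<^sub>p g \<in> lins"
  by (induction rule: lin_poly_induct)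
     (auto simp: pcompose_monom pcompose_add intro: add_lin smult_lin power_lin)

text \<open>Composition is additive in its left argument for any polynomials; in the right argument,
  additivity comes from that of the maps \<open>x ^ (q ^ i)\<close>.\<close>

lemma pcompose_add_right: "h \<in> lins \<Longrightarrow> h \<circ>\<^sub>p (g + g') = h \<circ>\<^sub>p g + h \<circ>\<^sub>p g'"
  by (induction rule: lin_poly_induct)
     (auto simp: pcompose_monom pcompose_add add_power_q smult_add_right)

lemma coeff_0_lin: "p \<in> lins \<Longrightarrow> coeff p 0 = 0"
  unfolding lin_polys_def using q_gt_1 by fastforce

lemma degree_lin:
  assumes "g \<in> lins" "g \<noteq> 0"
  shows "degree g = q ^ qdegree q g"
proof -
  obtain j where j: "degree g = q ^ j"
    using assms leading_coeff_0_iff[of g] unfolding lin_polys_def by blast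
  have le: "i \<le> j" if "lin_coeff q g i \<noteq> 0" for i
    by (metis j le_degree lin_coeff_def power_le_imp_le_exp q_gt_1 that)
  have "lin_coeff q g j \<noteq> 0" using assms j by (metis leading_coeff_0_iff lin_coeff_def)
  then have "qdegree q g = j" unfolding qdegree_def
    by (intro Max_eqI) (use le in \<open>auto intro: finite_subset[of _ "{..j}"]\<close>)
  with j show ?thesis by simp
qed

lemma degree_lin_pos: "g \<in> lins \<Longrightarrow> g \<noteq> 0 \<Longrightarrow> degree g > 0"
  by (subst degree_lin) (assumption | rule q_power_pos)+

text \<open>As \<open>degree 0 = 0 < q ^ t\<close>, ordinary degrees treat the zero polynomial
  uniformly, where \<open>qdegree\<close> needs an exception.\<close>

lemma lin_polys_less_iff: "p \<in> lin_polys_less q t \<longleftrightarrow> p \<in> lins \<and> degree p < q ^ t"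
  using q_gt_1 by (cases "p = 0") (auto simp: lin_polys_less_def degree_lin)

section \<open>Right division and principal left ideals\<close>

lemma right_division_exists:
  assumes "p \<in> lins" "g \<in> lins" "g \<noteq> 0"
  shows "\<exists>h\<in>lins. \<exists>r\<in>lins. p = h \<circ>\<^sub>p g + r \<and> degree r < degree g"
  using assms(1)
proof (induction "degree p" arbitrary: p rule: less_induct)
  case less
  show ?case
  proof (cases "degree p < degree g")
    case True
    then show ?thesis using less.prems by (intro bexI[of _ 0] bexI[of _ p]) auto
  next
    case False
    let ?a = "qdegree q p" and ?b = "qdegree q g"
    from False degree_lin_pos[OF assms(2,3)] have "p \<noteq> 0" by auto
    then have dp: "degree p = q ^ ?a" using degree_lin less.prems by blast
    have dg: "degree g = q ^ ?b" using degree_lin assms by blast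
    have ab: "?b \<le> ?a" using False dp dg q_gt_1 by simp
    \<comment> \<open>Composing \<open>monom c (q ^ j)\<close> with \<open>g\<close> raises the
      leading coefficient of \<open>g\<close> to the power \<open>q ^ j\<close>; dividing by that
      power gives \<open>u \<circ>\<^sub>p g\<close> the leading term of \<open>p\<close>.\<close>
    define u where "u = monom (lead_coeff p / lead_coeff g ^ q ^ (?a - ?b)) (q ^ (?a - ?b))"
    have u: "u \<in> lins" by (simp add: u_def)
    have "lead_coeff p / lead_coeff g ^ q ^ (?a - ?b) \<noteq> 0" using assms \<open>p \<noteq> 0\<close> by simp
    then have deg: "degree (u \<circ>\<^sub>p g) = degree p"
      using ab by (simp add: u_def degree_pcompose degree_monom_eq dg dp flip: power_add)
    have "lead_coeff (u \<circ>\<^sub>p g) = lead_coeff p"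
      using assms by (simp add: u_def pcompose_monom lead_coeff_power)
    then have "coeff (p - u \<circ>\<^sub>p g) (degree p) = 0" using deg by simp
    moreover have "degree (p - u \<circ>\<^sub>p g) \<le> degree p" using deg by (simp add: degree_diff_le)
    \<comment> \<open>A difference of unchanged degree would have leading coefficient 0, hence be 0,
      of degree 0 and not \<open>q ^ ?a\<close>.\<close>
    ultimately have "degree (p - u \<circ>\<^sub>p g) < degree p"
      using dp by (metis degree_0 leading_coeff_0_iff nat_less_le q_power_pos)
    with less.hyps[OF this] obtain h r where h: "h \<in> lins" and r: "r \<in> lins"
      and *: "p - u \<circ>\<^sub>p g = h \<circ>\<^sub>p g + r" "degree r < degree g"
      using diff_lin[OF less.prems pcompose_lin[OF u assms(2)]] by blast
    have "p = (u + h) \<circ>\<^sub>p g + r" using *(1) by (simp add: pcompose_add algebra_simps)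
    with * u h r show ?thesis by (intro bexI[of _ "u + h"] bexI[of _ r]) (auto intro: add_lin)
  qed
qed

lemma left_ideal_0 [simp]: "0 \<in> lideal g"
  and self_left_ideal: "g \<in> lideal g"
  and left_ideal_add: "p \<in> lideal g \<Longrightarrow> p' \<in> lideal g \<Longrightarrow> p + p' \<in> lideal g"
  and left_ideal_uminus: "p \<in> lideal g \<Longrightarrow> - p \<in> lideal g"
  and left_ideal_pcompose: "h \<in> lins \<Longrightarrow> p \<in> lideal g \<Longrightarrow> h \<circ>\<^sub>p p \<in> lideal g"
proof -
  show "0 \<in> lideal g"
    unfolding left_ideal_def mem_Collect_eq by (intro exI[of _ 0]) simp
  show "g \<in> lideal g"
    unfolding left_ideal_def mem_Collect_eq by (intro exI[of _ "[:0, 1:]"]) (simp add: pcompose_pCons)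
  show "p + p' \<in> lideal g" if "p \<in> lideal g" "p' \<in> lideal g"
    using that unfolding left_ideal_def by (auto simp flip: pcompose_add intro: add_lin)
  show "- p \<in> lideal g" if "p \<in> lideal g"
    using that unfolding left_ideal_def by (auto simp flip: pcompose_uminus intro: uminus_lin)
  show "h \<circ>\<^sub>p p \<in> lideal g" if "h \<in> lins" "p \<in> lideal g"
    using that unfolding left_ideal_def by (auto simp: pcompose_assoc intro: pcompose_lin)
qed

lemma left_ideal_diff: "p \<in> lideal g \<Longrightarrow> p' \<in> lideal g \<Longrightarrow> p - p' \<in> lideal g"
  using left_ideal_add[OF _ left_ideal_uminus] by fastforce

lemma left_ideal_sum: "(\<And>i. i \<in> A \<Longrightarrow> p i \<in> lideal g) \<Longrightarrow> sum p A \<in> lideal g"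
  by (induction A rule: infinite_finite_induct) (auto intro: left_ideal_add)

text \<open>Degrees multiply under composition and a nonzero linearized factor has positive degree,
  so a nonzero left multiple of \<open>g\<close> has degree at least that of \<open>g\<close>. This
  gives uniqueness of remainders and, later, injectivity of the lift.\<close>

lemma left_ideal_degree_less:
  assumes "p \<in> lideal g" "degree p < degree g"
  shows "p = 0"
proof -
  obtain h where h: "h \<in> lins" "p = h \<circ>\<^sub>p g" using assms(1) unfolding left_ideal_def by blast
  then have "h = 0" using assms(2) degree_lin_pos[of h] by (fastforce simp: degree_pcompose)
  with h show ?thesis by simp
qed

text \<open>Euclidean argument: dividing an element of \<open>I\<close> by a nonzero element of
  minimal degree leaves a remainder in \<open>I\<close> of smaller degree, hence 0.\<close>

lemma left_ideal_principal:
  assumes "I \<subseteq> lins" "0 \<in> I" and add: "\<And>p p'. p \<in> I \<Longrightarrow> p' \<in> I \<Longrightarrow> p + p' \<in> I"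
    and mult: "\<And>h p. h \<in> lins \<Longrightarrow> p \<in> I \<Longrightarrow> h \<circ>\<^sub>p p \<in> I"
  shows "\<exists>g\<in>I. I = lideal g"
proof (cases "I = {0}")
  case True
  \<comment> \<open>Composing with 0 leaves the constant coefficient, which vanishes for linearized
    polynomials, so 0 generates the zero ideal.\<close>
  then show ?thesis
    by (intro bexI[of _ 0]) (auto simp: left_ideal_def pcompose_0' coeff_0_lin intro: exI[of _ 0])
next
  case False
  with assms(2) obtain p0 where "p0 \<in> I \<and> p0 \<noteq> 0" by blast
  then obtain g where g: "g \<in> I" "g \<noteq> 0"
    and min: "\<And>p. p \<in> I \<Longrightarrow> p \<noteq> 0 \<Longrightarrow> degree g \<le> degree p"
    using ex_has_least_nat[of "\<lambda>p. p \<in> I \<and> p \<noteq> 0" p0 degree] by blast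
  have "p \<in> lideal g" if p: "p \<in> I" for p
  proof -
    obtain h r where hr: "h \<in> lins" "p = h \<circ>\<^sub>p g + r" "degree r < degree g"
      using right_division_exists[of p g] p g assms(1) by blast
    have "r = p + (- h) \<circ>\<^sub>p g" using hr by (simp add: pcompose_uminus)
    then have "r \<in> I" using add mult[OF uminus_lin[OF hr(1)] g(1)] p by simp
    with hr min have "r = 0" by (meson leD)
    with hr show ?thesis unfolding left_ideal_def by auto
  qed
  moreover have "lideal g \<subseteq> I" using g mult unfolding left_ideal_def by blast
  ultimately show ?thesis using g by blast
qed

section \<open>Least left common multiples and Bezout coefficients\<close>

lemma is_llcm_llcm: "is_llcm q (llcm q F) F" for F :: "'a poly set"
proof -
  let ?I = "lins \<inter> (\<Inter>f\<in>F. lideal f)"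
  \<comment> \<open>The intersection is a left ideal, hence principal, so the choice in
    \<open>llcm\<close> succeeds.\<close>
  have "\<exists>g\<in>?I. ?I = lideal g"
    by (rule left_ideal_principal) (auto intro: add_lin left_ideal_add pcompose_lin left_ideal_pcompose)
  then show ?thesis unfolding llcm_def by (intro someI_ex[of "\<lambda>g. is_llcm q g F"]) (auto simp: is_llcm_def)
qed

lemma llcm_lin: "llcm q F \<in> lins" for F :: "'a poly set"
  using is_llcm_llcm unfolding is_llcm_def by blast

lemma left_ideal_llcm: "lideal (llcm q F) = lins \<inter> (\<Inter>f\<in>F. lideal f)" for F :: "'a poly set"
  using is_llcm_llcm unfolding is_llcm_def by blast

lemma llcm_left_ideal: "f \<in> F \<Longrightarrow> llcm q F \<in> lideal f"
  using self_left_ideal[of "llcm q F"] left_ideal_llcm[of F] by blast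

text \<open>The left combinations of \<open>b\<close> and \<open>f\<close> form a left ideal, which
  is principal. Its generator right-divides both, so by coprimality it right-divides
  \<open>[:0, 1:]\<close>, which is therefore such a combination.\<close>

lemma bezout_coeff:
  assumes "f \<in> lins" "b \<in> lins" "lin_coprime q f b"
  shows "bezout_coeff q b f \<in> lins"
    and "\<exists>S2\<in>lins. bezout_coeff q b f \<circ>\<^sub>p b + S2 \<circ>\<^sub>p f = [:0, 1:]"
proof -
  let ?I = "{u \<circ>\<^sub>p b + v \<circ>\<^sub>p f | u v. u \<in> lins \<and> v \<in> lins}"
  have in_I: "u \<circ>\<^sub>p b + v \<circ>\<^sub>p f \<in> ?I" if "u \<in> lins" "v \<in> lins" for u v
    using that by blast
  have "\<exists>g\<in>?I. ?I = lideal g"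
  proof (rule left_ideal_principal)
    show "?I \<subseteq> lins" using assms by (auto intro: add_lin pcompose_lin)
    show "0 \<in> ?I" using in_I[of 0 0] by simp
    show "p + p' \<in> ?I" if pI: "p \<in> ?I" "p' \<in> ?I" for p p'
    proof -
      obtain u v u' v' where "u \<in> lins" "v \<in> lins" "u' \<in> lins" "v' \<in> lins"
        and "p = u \<circ>\<^sub>p b + v \<circ>\<^sub>p f" "p' = u' \<circ>\<^sub>p b + v' \<circ>\<^sub>p f" using pI by blast
      then show ?thesis using in_I[of "u + u'" "v + v'"]
        by (simp add: add_lin pcompose_add algebra_simps)
    qed
    show "h \<circ>\<^sub>p p \<in> ?I" if h: "h \<in> lins" and pI: "p \<in> ?I" for h p
    proof -
      obtain u v where "u \<in> lins" "v \<in> lins" "p = u \<circ>\<^sub>p b + v \<circ>\<^sub>p f" using pI by blast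
      then show ?thesis using in_I[of "h \<circ>\<^sub>p u" "h \<circ>\<^sub>p v"] h
        by (simp add: pcompose_lin pcompose_add_right pcompose_assoc)
    qed
  qed
  then obtain g where g: "g \<in> ?I" "?I = lideal g" by blast
  have "b \<in> ?I" "f \<in> ?I" using in_I[of "[:0, 1:]" 0] in_I[of 0 "[:0, 1:]"]
    by (simp_all add: pcompose_pCons)
  then have "right_divides q g b" "right_divides q g f"
    unfolding g(2) by (auto simp: right_divides_def left_ideal_def)
  moreover have "g \<in> lins" using g(1) assms by (auto intro: add_lin pcompose_lin)
  ultimately have "right_divides q g [:0, 1:]"
    using assms(3) unfolding lin_coprime_def is_gcrd_def by blast
  then have "[:0, 1:] \<in> ?I" unfolding g(2) by (auto simp: right_divides_def left_ideal_def)
  then have "\<exists>S1. S1 \<in> lins \<and> (\<exists>S2\<in>lins. S1 \<circ>\<^sub>p b + S2 \<circ>\<^sub>p f = [:0, 1:])"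
    unfolding mem_Collect_eq by metis
  from someI_ex[OF this] show "bezout_coeff q b f \<in> lins"
    and "\<exists>S2\<in>lins. bezout_coeff q b f \<circ>\<^sub>p b + S2 \<circ>\<^sub>p f = [:0, 1:]"
    unfolding bezout_coeff_def by blast+
qed

text \<open>Two remainders differ by an element of \<open>lideal g\<close> of degree less than that
  of \<open>g\<close>, which is 0; so the definite description in \<open>right_rem\<close>
  denotes.\<close>

lemma right_rem:
  assumes "p \<in> lins" "g \<in> lins" "g \<noteq> 0"
  shows "right_rem q p g \<in> lins" "degree (right_rem q p g) < degree g"
    and "p - right_rem q p g \<in> lideal g"
proof -
  let ?P = "\<lambda>r. r \<in> lin_polys_less q (qdegree q g) \<and> (\<exists>h\<in>lins. p = h \<circ>\<^sub>p g + r)"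
  have P_iff: "?P r \<longleftrightarrow> r \<in> lins \<and> degree r < degree g \<and> p - r \<in> lideal g" for r
    using assms by (auto simp: lin_polys_less_iff degree_lin left_ideal_def algebra_simps)
  have "\<exists>!r. ?P r" unfolding P_iff
  proof (rule ex_ex1I)
    obtain h r where hr: "h \<in> lins" "r \<in> lins" "p = h \<circ>\<^sub>p g + r" "degree r < degree g"
      using right_division_exists[OF assms] by blast
    then have "p - r = h \<circ>\<^sub>p g" by simp
    with hr show "\<exists>r. r \<in> lins \<and> degree r < degree g \<and> p - r \<in> lideal g"
      unfolding left_ideal_def by blast
  next
    fix r r'
    assume *: "r \<in> lins \<and> degree r < degree g \<and> p - r \<in> lideal g"
      "r' \<in> lins \<and> degree r' < degree g \<and> p - r' \<in> lideal g"
    then have "(p - r) - (p - r') \<in> lideal g" using left_ideal_diff by blast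
    then have "r' - r \<in> lideal g" by simp
    then show "r = r'" using left_ideal_degree_less[of "r' - r" g] degree_diff_less[of r' "degree g" r] * by simp
  qed
  from theI'[OF this] show "right_rem q p g \<in> lins" "degree (right_rem q p g) < degree g"
    and "p - right_rem q p g \<in> lideal g"
    unfolding P_iff right_rem_def by blast+
qed


section \<open>Polynomials as coefficient vectors\<close>

definition lin_of :: "nat \<Rightarrow> (nat \<Rightarrow> 'a) \<Rightarrow> 'a poly" where
  "lin_of t e = (\<Sum>j<t. monom (e j) (q ^ j))"

lemma lin_coeff_sum_monom:
  "finite J \<Longrightarrow> lin_coeff q (\<Sum>j\<in>J. monom (e j) (q ^ j)) i = (if i \<in> J then e i else 0)"
  for e :: "nat \<Rightarrow> 'a"
  by (simp add: lin_coeff_def coeff_sum coeff_monom sum.delta)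

lemma lin_coeff_lin_of: "lin_coeff q (lin_of t e) i = (if i < t then e i else 0)"
  by (simp add: lin_of_def lin_coeff_sum_monom)

lemma lin_of_less: "lin_of t e \<in> lin_polys_less q t"
  unfolding lin_polys_less_iff lin_of_def
proof
  show "(\<Sum>j<t. monom (e j) (q ^ j)) \<in> lins" by (intro sum_lin) simp
  show "degree (\<Sum>j<t. monom (e j) (q ^ j)) < q ^ t"
  proof (rule degree_sum_less)
    fix j assume "j \<in> {..<t}"
    then have "q ^ j < q ^ t" using q_gt_1 by simp
    then show "degree (monom (e j) (q ^ j)) < q ^ t" using degree_monom_le le_less_trans by blast
  qed simp
qed

lemma lin_coeff_less:
  fixes p :: "'a poly"
  assumes "p \<in> lin_polys_less q t" "t \<le> i"
  shows "lin_coeff q p i = 0"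
proof -
  have "q ^ t \<le> q ^ i" using assms(2) q_gt_1 by simp
  then show ?thesis using assms(1) unfolding lin_polys_less_iff lin_coeff_def by (intro coeff_eq_0) linarith
qed

lemma lin_poly_eqI:
  assumes "p \<in> lins" "p' \<in> lins" "\<And>i. lin_coeff q p i = lin_coeff q p' i"
  shows "p = p'"
proof (rule poly_eqI)
  fix i
  show "coeff p i = coeff p' i"
  proof (cases "\<exists>j. i = q ^ j")
    case True
    with assms(3) show ?thesis by (auto simp: lin_coeff_def)
  next
    case False
    with assms(1,2) have "coeff p i = 0" "coeff p' i = 0" unfolding lin_polys_def by blast+
    then show ?thesis by simp
  qed
qed

text \<open>Lets polynomials be counted and compared through coordinates; \<open>restrict\<close> is
  there because \<open>vectors\<close> consists of extensional functions.\<close>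

lemma bij_betw_lin_coeff:
  "bij_betw (\<lambda>p. restrict (lin_coeff q p) {..<t}) (lin_polys_less q t) (vectors t :: (nat \<Rightarrow> 'a) set)"
proof (rule bij_betw_byWitness[where f' = "lin_of t"])
  show "\<forall>p\<in>lin_polys_less q t. lin_of t (restrict (lin_coeff q p) {..<t}) = p"
    using lin_of_less by (auto intro!: lin_poly_eqI simp: lin_coeff_lin_of lin_coeff_less lin_polys_less_iff)
  show "\<forall>e\<in>vectors t. restrict (lin_coeff q (lin_of t e)) {..<t} = e"
    by (auto simp: vectors_def lin_coeff_lin_of fun_eq_iff PiE_iff extensional_def)
  show "(\<lambda>p. restrict (lin_coeff q p) {..<t}) ` lin_polys_less q t \<subseteq> vectors t"
    by (simp add: vectors_def image_subset_iff)
  show "lin_of t ` vectors t \<subseteq> lin_polys_less q t" using lin_of_less by blast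
qed

lemma vector_block_eq: "vector_block q d e i = lin_of (d i) (\<lambda>j. e ((\<Sum>l<i. d l) + j))" for e :: "nat \<Rightarrow> 'a"
  by (simp add: vector_block_def lin_of_def)

end

text \<open>Serves to turn equality of all blocks into equality of the concatenated vectors.\<close>

lemma in_block:
  fixes d :: "nat \<Rightarrow> nat"
  shows "x < (\<Sum>i<s. d i) \<Longrightarrow> \<exists>i<s. \<exists>j<d i. x = (\<Sum>l<i. d l) + j"
proof (induction s)
  case (Suc s)
  show ?case
  proof (cases "x < (\<Sum>i<s. d i)")
    case True
    with Suc.IH show ?thesis using less_Suc_eq by blast
  next
    case False
    with Suc.prems show ?thesis
      by (intro exI[of _ s] conjI exI[of _ "x - (\<Sum>i<s. d i)"]) auto
  qed
qed simp

section \<open>The Chinese Remainder lift over a finite field\<close>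

locale finite_linearized_polynomials = linearized_polynomials q field_type
  for q and field_type :: "'a::{field,finite} itself"
begin

lemma card_lin_polys_less: "card (lin_polys_less q t :: 'a poly set) = CARD('a) ^ t"
  using bij_betw_same_card[OF bij_betw_lin_coeff, of t] by (simp add: vectors_def card_PiE)

lemma finite_lin_polys_less: "finite (lin_polys_less q t :: 'a poly set)"
  using card_lin_polys_less[of t] by (intro card_ge_0_finite) simp

text \<open>There are more polynomials of \<open>q\<close>-degree at most \<open>\<Sum>i<s. qdegree q (f i)\<close>
  than tuples of remainders, so two of them have the same remainders; take their difference.\<close>

lemma common_left_multiple_exists:
  fixes s :: nat
  assumes "\<And>i. i < s \<Longrightarrow> f i \<in> lins" "\<And>i. i < s \<Longrightarrow> f i \<noteq> 0"
  shows "\<exists>P. P \<in> lins \<and> P \<noteq> 0 \<and> degree P \<le> q ^ (\<Sum>i<s. qdegree q (f i)) \<and> (\<forall>i<s. P \<in> lideal (f i))"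
proof -
  let ?n = "\<Sum>i<s. qdegree q (f i)"
  let ?rems = "\<lambda>p. \<lambda>i\<in>{..<s}. right_rem q p (f i)"
  let ?T = "\<Pi>\<^sub>E i\<in>{..<s}. lin_polys_less q (qdegree q (f i)) :: 'a poly set"
  have maps: "?rems ` lin_polys_less q (Suc ?n) \<subseteq> ?T"
  proof (rule image_subsetI)
    fix p :: "'a poly" assume "p \<in> lin_polys_less q (Suc ?n)"
    then have p: "p \<in> lins" by (simp add: lin_polys_less_iff)
    show "?rems p \<in> ?T"
      unfolding restrict_PiE_iff
      using right_rem(1,2)[OF p assms] by (simp add: lin_polys_less_iff degree_lin[OF assms])
  qed
  have "finite ?T" by (rule finite_PiE) (simp_all add: finite_lin_polys_less)
  then have "card (?rems ` lin_polys_less q (Suc ?n)) \<le> card ?T" using maps by (rule card_mono)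
  also have "card ?T = CARD('a) ^ ?n" by (simp add: card_PiE card_lin_polys_less power_sum)
  also have "\<dots> < CARD('a) ^ Suc ?n" using card_mono[of "UNIV :: 'a set" "{0, 1}"] by simp
  also have "\<dots> = card (lin_polys_less q (Suc ?n) :: 'a poly set)" by (simp add: card_lin_polys_less)
  finally have "\<not> inj_on ?rems (lin_polys_less q (Suc ?n))" by (rule pigeonhole)
  then obtain p p' where p: "p \<in> lin_polys_less q (Suc ?n)" "p' \<in> lin_polys_less q (Suc ?n)" "p \<noteq> p'"
    and eq: "?rems p = ?rems p'" unfolding inj_on_def by blast
  let ?P = "p - p'"
  have lins: "p \<in> lins" "p' \<in> lins" and deg: "degree p < q ^ Suc ?n" "degree p' < q ^ Suc ?n"
    using p unfolding lin_polys_less_iff by auto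
  have P: "?P \<in> lins" "?P \<noteq> 0" using lins p(3) by (auto intro: diff_lin)
  have "degree ?P < q ^ Suc ?n" by (rule degree_diff_less[OF deg])
  then have "qdegree q ?P < Suc ?n" unfolding degree_lin[OF P] using q_gt_1 by (metis power_less_imp_less_exp)
  then have "degree ?P \<le> q ^ ?n" unfolding degree_lin[OF P] using q_gt_1 by (simp add: power_increasing)
  moreover have "?P \<in> lideal (f i)" if "i < s" for i
  proof -
    have "right_rem q p (f i) = right_rem q p' (f i)" using fun_cong[OF eq, of i] that by simp
    then have "?P = (p - right_rem q p (f i)) - (p' - right_rem q p' (f i))" by simp
    then show ?thesis
      using left_ideal_diff[OF right_rem(3)[OF lins(1) assms[OF that]] right_rem(3)[OF lins(2) assms[OF that]]] by simp
  qed
  ultimately show ?thesis using P by blast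
qed

text \<open>The nonzero common left multiple \<open>P\<close> of bounded degree lies in the left
  ideal of the least one, so the latter is nonzero and of no larger degree.\<close>

lemma llcm_nonzero:
  fixes s :: nat
  assumes "\<And>i. i < s \<Longrightarrow> f i \<in> lins" "\<And>i. i < s \<Longrightarrow> f i \<noteq> 0"
  shows "llcm q (f ` {..<s}) \<noteq> 0" "degree (llcm q (f ` {..<s})) \<le> q ^ (\<Sum>i<s. qdegree q (f i))"
proof -
  let ?L = "llcm q (f ` {..<s})"
  obtain P where P: "P \<in> lins" "P \<noteq> 0" "degree P \<le> q ^ (\<Sum>i<s. qdegree q (f i))" "\<forall>i<s. P \<in> lideal (f i)"
    using common_left_multiple_exists[of s f, OF assms] by blast
  then have mem: "P \<in> lideal ?L" unfolding left_ideal_llcm by auto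
  then obtain h where h: "h \<in> lins" "P = h \<circ>\<^sub>p ?L" unfolding left_ideal_def by blast
  show "?L \<noteq> 0"
  proof
    assume "?L = 0"
    with h have "P = 0" by (simp add: pcompose_0' coeff_0_lin)
    with P(2) show False by contradiction
  qed
  show "degree ?L \<le> q ^ (\<Sum>i<s. qdegree q (f i))"
    using left_ideal_degree_less[OF mem] P(2,3) by linarith
qed

context
  fixes s :: nat and f :: "nat \<Rightarrow> 'a poly"
  assumes f_lin: "\<And>i. i < s \<Longrightarrow> f i \<in> lins" and f_nonzero: "\<And>i. i < s \<Longrightarrow> f i \<noteq> 0"
    and f_coprime: "\<And>i. i < s \<Longrightarrow> lin_coprime q (f i) (other_llcm q s f i)"
begin

text \<open>Modulo \<open>f i\<close>, every summand with index \<open>j\<close> other than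
  \<open>i\<close> vanishes, because \<open>f i\<close> right-divides
  \<open>other_llcm q s f j\<close>; the summand \<open>i\<close> is \<open>p i\<close> by the
  Bezout identity. The final reduction changes the sum only by a left multiple of every
  \<open>f i\<close>.\<close>

lemma crt_lift:
  assumes p: "\<And>i. i < s \<Longrightarrow> p i \<in> lins"
  shows "crt_lift q s f p \<in> lin_polys_less q (\<Sum>i<s. qdegree q (f i))"
    and "i < s \<Longrightarrow> crt_lift q s f p - p i \<in> lideal (f i)"
proof -
  let ?b = "other_llcm q s f"
  let ?S = "\<lambda>i. bezout_coeff q (?b i) (f i)"
  let ?L = "llcm q (f ` {..<s})"
  let ?z = "\<Sum>i<s. p i \<circ>\<^sub>p ?S i \<circ>\<^sub>p ?b i"
  have b: "?b i \<in> lins" for i unfolding other_llcm_def by (rule llcm_lin)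
  have S: "?S i \<in> lins" "\<exists>S2\<in>lins. ?S i \<circ>\<^sub>p ?b i + S2 \<circ>\<^sub>p f i = [:0, 1:]" if "i < s" for i
    using bezout_coeff[OF f_lin b f_coprime] that by blast+
  have z: "?z \<in> lins" using p S b by (intro sum_lin pcompose_lin) auto
  note L = llcm_nonzero[of s f, OF f_lin f_nonzero]
  note rem = right_rem[OF z llcm_lin L(1), folded crt_lift_def]
  show "crt_lift q s f p \<in> lin_polys_less q (\<Sum>i<s. qdegree q (f i))"
    using rem(1,2) L(2) by (auto simp: lin_polys_less_iff)
  show "crt_lift q s f p - p i \<in> lideal (f i)" if i: "i < s"
  proof -
    obtain S2 where S2: "S2 \<in> lins" "?S i \<circ>\<^sub>p ?b i + S2 \<circ>\<^sub>p f i = [:0, 1:]" using S(2)[OF i] by blast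
    have "p i = p i \<circ>\<^sub>p (?S i \<circ>\<^sub>p ?b i + S2 \<circ>\<^sub>p f i)" unfolding S2(2) by simp
    also have "\<dots> = p i \<circ>\<^sub>p ?S i \<circ>\<^sub>p ?b i + p i \<circ>\<^sub>p S2 \<circ>\<^sub>p f i"
      using p[OF i] by (simp add: pcompose_add_right pcompose_assoc)
    finally have p_i: "p i = p i \<circ>\<^sub>p ?S i \<circ>\<^sub>p ?b i + p i \<circ>\<^sub>p S2 \<circ>\<^sub>p f i" .
    have "p i \<circ>\<^sub>p S2 \<circ>\<^sub>p f i \<in> lideal (f i)"
      using pcompose_lin[OF p[OF i] S2(1)] unfolding left_ideal_def by blast
    moreover have "(\<Sum>j\<in>{..<s} - {i}. p j \<circ>\<^sub>p ?S j \<circ>\<^sub>p ?b j) \<in> lideal (f i)"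
    proof (rule left_ideal_sum)
      fix j assume j: "j \<in> {..<s} - {i}"
      have "?b j \<in> lideal (f i)" unfolding other_llcm_def
        by (rule llcm_left_ideal) (use i j in auto)
      then show "p j \<circ>\<^sub>p ?S j \<circ>\<^sub>p ?b j \<in> lideal (f i)"
        using j p S by (intro left_ideal_pcompose pcompose_lin) auto
    qed
    moreover have "?z - crt_lift q s f p \<in> lideal (f i)"
      using rem(3) i unfolding left_ideal_llcm by blast
    moreover have "?z = p i \<circ>\<^sub>p ?S i \<circ>\<^sub>p ?b i + (\<Sum>j\<in>{..<s} - {i}. p j \<circ>\<^sub>p ?S j \<circ>\<^sub>p ?b j)"
      using i by (intro sum.remove) auto
    then have "crt_lift q s f p - p i = (\<Sum>j\<in>{..<s} - {i}. p j \<circ>\<^sub>p ?S j \<circ>\<^sub>p ?b j)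
        - p i \<circ>\<^sub>p S2 \<circ>\<^sub>p f i - (?z - crt_lift q s f p)"
      using p_i by (simp add: algebra_simps)
    ultimately show ?thesis by (simp only: left_ideal_diff)
  qed
qed

text \<open>If two lifts agree, their blocks are congruent modulo \<open>f i\<close> and, having
  \<open>q\<close>-degree below \<open>d i\<close>, coincide. Surjectivity follows because
  \<open>vectors n\<close> is finite.\<close>

lemma bij_betw_crt_lift:
  fixes d :: "nat \<Rightarrow> nat"
  assumes d: "\<And>i. i < s \<Longrightarrow> qdegree q (f i) = d i"
  defines "n \<equiv> \<Sum>i<s. d i"
  shows "bij_betw (\<lambda>e. restrict (lin_coeff q (crt_lift q s f (vector_block q d e))) {..<n})
    (vectors n) (vectors n)"
proof -
  let ?E = "\<lambda>e. crt_lift q s f (vector_block q d e)"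
  let ?g = "\<lambda>e. restrict (lin_coeff q (?E e)) {..<n}"
  have block: "vector_block q d e i \<in> lin_polys_less q (d i)" for e :: "nat \<Rightarrow> 'a" and i
    unfolding vector_block_eq by (rule lin_of_less)
  then have block_lin: "vector_block q d e i \<in> lins" for e :: "nat \<Rightarrow> 'a" and i
    by (simp add: lin_polys_less_iff)
  have E: "?E e \<in> lin_polys_less q n" for e
    using crt_lift(1)[OF block_lin] d by (simp add: n_def)
  have inj: "inj_on ?g (vectors n)"
  proof (rule inj_onI)
    fix e e' :: "nat \<Rightarrow> 'a"
    assume e: "e \<in> vectors n" "e' \<in> vectors n" and eq: "?g e = ?g e'"
    have E_eq: "?E e = ?E e'"
      using bij_betw_imp_inj_on[OF bij_betw_lin_coeff] eq E by (auto dest: inj_onD)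
    have "vector_block q d e i = vector_block q d e' i" if i: "i < s" for i
    proof -
      have "(?E e - vector_block q d e' i) - (?E e - vector_block q d e i) \<in> lideal (f i)"
        using crt_lift(2)[of "vector_block q d e", OF block_lin i]
          crt_lift(2)[of "vector_block q d e'", OF block_lin i]
        by (simp only: E_eq left_ideal_diff)
      then have mem: "vector_block q d e i - vector_block q d e' i \<in> lideal (f i)" by simp
      have "degree (vector_block q d e i - vector_block q d e' i) < degree (f i)"
        using block[of e i] block[of e' i] d[OF i]
        by (simp add: lin_polys_less_iff degree_lin[OF f_lin f_nonzero] i degree_diff_less)
      with left_ideal_degree_less[OF mem] show ?thesis by simp
    qed
    then have coeffs: "e ((\<Sum>l<i. d l) + j) = e' ((\<Sum>l<i. d l) + j)" if "i < s" "j < d i" for i j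
      using that lin_coeff_lin_of unfolding vector_block_eq by metis
    show "e = e'"
    proof (rule PiE_ext)
      show "e \<in> {..<n} \<rightarrow>\<^sub>E UNIV" "e' \<in> {..<n} \<rightarrow>\<^sub>E UNIV" using e by (auto simp: vectors_def)
      show "e x = e' x" if "x \<in> {..<n}" for x
        using in_block[of x d s] that coeffs unfolding n_def by auto
    qed
  qed
  have "?g ` vectors n \<subseteq> vectors n" by (auto simp: vectors_def)
  moreover have "finite (vectors n :: (nat \<Rightarrow> 'a) set)" by (simp add: vectors_def finite_PiE)
  ultimately have "?g ` vectors n = vectors n" using inj endo_inj_surj by blast
  with inj show ?thesis by (simp add: bij_betw_def)
qed

end

end

text \<open>Translation by 1 permutes the ring; comparing the sums of all elements before and after
  shows that \<open>CARD('a)\<close> times 1 is 0.\<close>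

lemma CHAR_dvd_card_UNIV: "CHAR('a::{ring_1,finite}) dvd CARD('a)"
proof -
  have "(\<Sum>x\<in>UNIV. x + 1 :: 'a) = (\<Sum>x\<in>UNIV. x)"
    by (rule sum.reindex_bij_witness[of _ "\<lambda>x. x - 1" "\<lambda>x. x + 1"]) auto
  then have "of_nat CARD('a) = (0 :: 'a)" by (simp add: sum.distrib)
  then show ?thesis by (simp add: of_nat_eq_0_iff_char_dvd)
qed

lemma finite_linearized_polynomialsI:
  assumes "primepow q" "CARD('a::{field,finite}) = q ^ m"
  shows "finite_linearized_polynomials TYPE('a) q"
proof unfold_locales
  obtain p e where p: "prime p" "e > 0" "q = p ^ e" using assms(1) unfolding primepow_def by blast
  show prime: "prime CHAR('a)" by (rule prime_CHAR_semidom) (simp add: finite_imp_CHAR_pos)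
  have "CHAR('a) dvd p ^ (e * m)" using CHAR_dvd_card_UNIV[where 'a = 'a] assms(2) p(3) by (simp add: power_mult)
  then have "CHAR('a) = p" using prime p(1) prime_dvd_power primes_dvd_imp_eq by blast
  with p show "\<exists>e>0. q = CHAR('a) ^ e" by blast
qed

section \<open>Counting families of given rank\<close>

text \<open>Induction on a basis: for \<open>x\<close> outside \<open>span B\<close>, every element
  of the larger span is uniquely \<open>c *s x + y\<close> with \<open>y\<close> in
  \<open>span B\<close>, which multiplies the count by the size of the field.\<close>

lemma (in finite_dimensional_vector_space) card_span:
  fixes S :: "'b set"
  assumes "finite (UNIV :: 'a set)"
  shows "card (span S) = card (UNIV :: 'a set) ^ dim S"
proof -
  have *: "card (span B) = card (UNIV :: 'a set) ^ card B" if "finite B" "independent B" for B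
    using that
  proof (induction B rule: finite_induct)
    case (insert x B)
    have indep: "independent B" and x: "x \<notin> span B"
      using insert.prems insert.hyps independent_insert by auto
    have span_eq: "span (insert x B) = (\<lambda>(c, y). c *s x + y) ` (UNIV \<times> span B)"
    proof (intro set_eqI iffI)
      fix v assume "v \<in> span (insert x B)"
      then obtain c where "v - c *s x \<in> span B" by (auto simp: span_breakdown_eq)
      then show "v \<in> (\<lambda>(c, y). c *s x + y) ` (UNIV \<times> span B)"
        by (intro image_eqI[of _ _ "(c, v - c *s x)"]) auto
    next
      fix v assume "v \<in> (\<lambda>(c, y). c *s x + y) ` (UNIV \<times> span B)"
      then obtain c y where "v = c *s x + y" "y \<in> span B" by auto
      then have "v - c *s x \<in> span B" by simp
      then show "v \<in> span (insert x B)" by (auto simp: span_breakdown_eq)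
    qed
    have "inj_on (\<lambda>(c, y). c *s x + y) (UNIV \<times> span B)"
    proof (rule inj_onI, clarify)
      fix c y c' y'
      assume y: "y \<in> span B" "y' \<in> span B" and eq: "c *s x + y = c' *s x + y'"
      then have "(c - c') *s x = y' - y" by (simp add: scale_left_diff_distrib algebra_simps)
      then have mem: "(c - c') *s x \<in> span B" using span_diff y by metis
      have "c = c'"
      proof (rule ccontr)
        assume "c \<noteq> c'"
        then show False using span_scale[OF mem, of "inverse (c - c')"] x by simp
      qed
      with eq show "c = c' \<and> y = y'" by simp
    qed
    then show ?case
      using insert.IH[OF indep] insert.hyps by (simp add: span_eq card_image card_cartesian_product)
  qed (simp add: span_empty)
  obtain B where "B \<subseteq> S" "independent B" "S \<subseteq> span B" "card B = dim S"
    using basis_exists by blast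
  moreover from this have "span B = span S" by (meson span_mono span_subspace span_superset subspace_span subset_antisym span_minimal)
  ultimately show ?thesis using *[of B] finiteI_independent by simp
qed

text \<open>The number of injective linear maps from a space of dimension \<^term>\<open>r\<close> to one of
  dimension \<^term>\<open>N\<close> over the field with \<^term>\<open>Q\<close> elements.\<close>

definition falling_q_power :: "real \<Rightarrow> nat \<Rightarrow> nat \<Rightarrow> real" where
  "falling_q_power Q N r = (\<Prod>i<r. Q ^ N - Q ^ i)"

text \<open>Split off the factor \<open>i = 0\<close> and take \<open>Q\<close> out of each
  remaining one.\<close>

lemma falling_q_power_Suc_Suc:
  "falling_q_power Q (Suc N) (Suc r) = (Q ^ Suc N - 1) * Q ^ r * falling_q_power Q N r"
proof -
  have "falling_q_power Q (Suc N) (Suc r) = (Q ^ Suc N - 1) * (\<Prod>i<r. Q * (Q ^ N - Q ^ i))"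
    unfolding falling_q_power_def prod.lessThan_Suc_shift by (simp add: algebra_simps)
  then show ?thesis by (simp add: falling_q_power_def prod.distrib)
qed

lemma falling_q_power_Suc: "falling_q_power Q N (Suc r) = falling_q_power Q N r * (Q ^ N - Q ^ r)"
  by (simp add: falling_q_power_def)

lemma falling_q_power_nonzero:
  assumes "Q > 1" "r \<le> N"
  shows "falling_q_power Q N r \<noteq> 0"
  using assms by (auto simp: falling_q_power_def)

text \<open>\<open>A N r\<close> is the expected number of \<open>N\<close> by \<open>m\<close>
  matrices of rank \<open>r\<close>: such a matrix is a surjection followed by an injection through
  dimension \<open>r\<close>, uniquely up to the \<open>falling_q_power Q r r\<close> automorphisms.
  The recursion is the one that appending a vector gives for the count.\<close>

lemma falling_q_power_recursion:
  fixes Q :: real and m :: nat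
  assumes "Q > 1"
  defines "A \<equiv> \<lambda>N r. falling_q_power Q N r * falling_q_power Q m r / falling_q_power Q r r"
  shows "A (Suc N) (Suc r) = A N (Suc r) * Q ^ Suc r + A N r * (Q ^ m - Q ^ r)"
proof -
  have nz: "falling_q_power Q r r \<noteq> 0" "Q ^ Suc r - 1 \<noteq> 0" "Q ^ r \<noteq> 0"
    using falling_q_power_nonzero[OF assms(1)] assms(1) one_less_power[of Q "Suc r"] by auto
  define F M D where "F = falling_q_power Q N r" "M = falling_q_power Q m r" "D = falling_q_power Q r r"
  define x y z w where "x = Q ^ N" "y = Q ^ r" "z = Q ^ m" "w = Q * y - 1"
  have "D \<noteq> 0" "w \<noteq> 0" "y \<noteq> 0" using nz by (simp_all add: F_M_D_def x_y_z_w_def)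
  have "A (Suc N) (Suc r) = (Q * x - 1) * y * F * (M * (z - y)) / (w * y * D)"
    unfolding A_def falling_q_power_Suc_Suc by (simp add: falling_q_power_Suc F_M_D_def x_y_z_w_def)
  moreover have "A N (Suc r) = F * (x - y) * (M * (z - y)) / (w * y * D)"
    unfolding A_def falling_q_power_Suc_Suc by (simp add: falling_q_power_Suc F_M_D_def x_y_z_w_def)
  moreover have "A N r = F * M / D" by (simp add: A_def F_M_D_def)
  moreover have "(Q * x - 1) * y * F * (M * (z - y)) / (w * y * D)
      = F * (x - y) * (M * (z - y)) / (w * y * D) * (Q * y) + F * M / D * (z - y)"
  proof -
    \<comment> \<open>After cancelling common factors the recursion is this identity, that is
      \<open>(Q ^ Suc N - 1) * Q ^ r = (Q ^ N - Q ^ r) * Q ^ Suc r + (Q ^ Suc r - 1) * Q ^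
      r\<close>.\<close>
    have "(Q * x - 1) * y = (x - y) * (Q * y) + w * y" unfolding x_y_z_w_def(4) by (simp add: algebra_simps)
    then have "(Q * x - 1) * y * F * (M * (z - y))
        = F * (x - y) * (M * (z - y)) * (Q * y) + F * M * (z - y) * (w * y)"
      by algebra
    then show ?thesis using \<open>D \<noteq> 0\<close> \<open>w \<noteq> 0\<close> \<open>y \<noteq> 0\<close> by (simp add: divide_simps) (simp add: algebra_simps)
  qed
  ultimately show ?thesis by (simp add: x_y_z_w_def)
qed

lemma vectors_0: "vectors 0 = {\<lambda>_. undefined}"
  by (simp add: vectors_def)

lemma finite_vectors: "finite (vectors N :: (nat \<Rightarrow> 'a::finite) set)"
  by (simp add: vectors_def finite_PiE)

lemma vectors_Suc: "vectors (Suc N) = (\<lambda>(x, c). c(N := x)) ` (UNIV \<times> vectors N)"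
  unfolding vectors_def lessThan_Suc by (rule PiE_insert_eq)

lemma card_vectors_Suc:
  "card {c \<in> vectors (Suc N). P c} = (\<Sum>c\<in>vectors N. card {x. P (c(N := x))})"
  for P :: "(nat \<Rightarrow> 'a::finite) \<Rightarrow> bool"
proof -
  have inj: "inj_on (\<lambda>(x, c). c(N := x)) (UNIV \<times> vectors N)"
    unfolding vectors_def by (rule inj_combinator) simp
  have "{c \<in> vectors (Suc N). P c}
      = (\<lambda>(x, c). c(N := x)) ` {(x, c). c \<in> vectors N \<and> P (c(N := x))}"
    unfolding vectors_Suc by auto
  also have "card \<dots> = card {(x, c). c \<in> vectors N \<and> P (c(N := x))}"
    by (rule card_image) (rule inj_on_subset[OF inj], auto)
  also have "\<dots> = card (SIGMA c:vectors N. {x. P (c(N := x))})"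
    by (rule bij_betw_same_card[of prod.swap]) (auto simp: bij_betw_def inj_on_def image_iff)
  also have "\<dots> = (\<Sum>c\<in>vectors N. card {x. P (c(N := x))})"
    by (rule card_SigmaI) (auto simp: finite_vectors)
  finally show ?thesis .
qed

section \<open>Families of vectors in a finite vector space\<close>

locale finite_vector_space = vector_space scale
  for scale :: "'k::{field,finite} \<Rightarrow> 'v::{ab_group_add,finite} \<Rightarrow> 'v" (infixr \<open>*s\<close> 75)
begin

text \<open>A basis inside a finite type is finite; this makes dimension theory, in particular
  \<open>card_span\<close>, available.\<close>

sublocale finite_dimensional_vector_space scale "extend_basis {}"
  by unfold_locales (auto simp: independent_extend_basis independent_empty span_extend_basis)

definition card_of_dim :: "nat \<Rightarrow> nat \<Rightarrow> nat" where
  "card_of_dim N r = card {c \<in> vectors N. dim (c ` {..<N}) = r}"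

lemma card_span_real: "real (card (span S)) = real CARD('k) ^ dim S"
  by (simp add: card_span)

lemma card_of_dim_0: "card_of_dim 0 r = (if r = 0 then 1 else 0)"
  by (auto simp: card_of_dim_def vectors_0)

lemma image_upd: "(c(N := x)) ` {..<Suc N} = insert x (c ` {..<N})"
  by (auto simp: lessThan_Suc image_iff)

lemma card_of_dim_Suc_0: "card_of_dim (Suc N) 0 = card_of_dim N 0"
proof -
  have "{x. dim (insert x (c ` {..<N})) = 0} = (if dim (c ` {..<N}) = 0 then {0} else {})" for c :: "nat \<Rightarrow> 'v"
    by auto
  then have "card_of_dim (Suc N) 0 = (\<Sum>c\<in>vectors N. if dim (c ` {..<N}) = 0 then 1 else 0)"
    unfolding card_of_dim_def card_vectors_Suc image_upd by (intro sum.cong) (simp_all del: dim_eq_0)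
  then show ?thesis
    by (simp add: card_of_dim_def finite_vectors sum.If_cases Int_def del: dim_eq_0)
qed

text \<open>Classify the families of length \<^term>\<open>Suc N\<close> by whether the last vector lies in the span
  of the first \<^term>\<open>N\<close>.\<close>

lemma card_of_dim_Suc_Suc:
  "real (card_of_dim (Suc N) (Suc r)) = real (card_of_dim N (Suc r)) * real CARD('k) ^ Suc r
     + real (card_of_dim N r) * (real CARD('v) - real CARD('k) ^ r)"
proof -
  have step: "real (card {x. dim (insert x (c ` {..<N})) = Suc r})
      = (if dim (c ` {..<N}) = Suc r then real CARD('k) ^ Suc r else 0)
        + (if dim (c ` {..<N}) = r then real CARD('v) - real CARD('k) ^ r else 0)"
    for c :: "nat \<Rightarrow> 'v"
  proof -
    let ?S = "c ` {..<N}"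
    have "{x. dim (insert x ?S) = Suc r} =
        (if dim ?S = Suc r then span ?S else if dim ?S = r then UNIV - span ?S else {})"
      by (auto simp: dim_insert split: if_splits)
    moreover have "real (card (UNIV - span ?S)) = real CARD('v) - real (card (span ?S))"
      by (subst card_Diff_subset) (auto simp: of_nat_diff card_mono)
    ultimately show ?thesis using card_span_real[of ?S] by auto
  qed
  have "real (card_of_dim (Suc N) (Suc r))
      = (\<Sum>c\<in>vectors N. real (card {x. dim (insert x (c ` {..<N})) = Suc r}))"
    unfolding card_of_dim_def card_vectors_Suc image_upd by simp
  then show ?thesis unfolding step sum.distrib
    by (simp add: card_of_dim_def finite_vectors sum.If_cases Int_def)
qed

text \<open>Both sides satisfy the same recursion in \<open>N\<close> and agree at
  \<open>N = 0\<close> and at \<open>r = 0\<close>.\<close>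

lemma card_of_dim_eq:
  assumes "CARD('v) = CARD('k) ^ m"
  defines "F \<equiv> falling_q_power (real CARD('k))"
  shows "real (card_of_dim N r) = F N r * F m r / F r r"
proof -
  have "CARD('k) > 1" using card_mono[of "UNIV :: 'k set" "{0, 1}"] by simp
  then have Q: "real CARD('k) > 1" by simp
  show ?thesis unfolding F_def
  proof (induction N arbitrary: r)
    case 0
    \<comment> \<open>For positive \<open>r\<close> both sides are 0: the factor
      \<open>i = 0\<close> of the product for \<open>N = 0\<close> vanishes.\<close>
    then show ?case
      by (cases r) (simp_all add: card_of_dim_0 falling_q_power_def prod.lessThan_Suc_shift del: prod.lessThan_Suc)
  next
    case (Suc N)
    then show ?case
    proof (cases r)
      case 0
      with Suc.IH[of 0] show ?thesis by (simp add: card_of_dim_Suc_0 falling_q_power_def)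
    next
      case (Suc r')
      then show ?thesis
        using falling_q_power_recursion[OF Q, of N r' m] card_of_dim_Suc_Suc[of N r'] Suc.IH assms(1)
        by simp
    qed
  qed
qed

text \<open>The spans agree exactly when the first \<open>t\<close> entries lie in the span of the
  last \<open>N\<close>. Splitting at \<open>t\<close> leaves a free choice of a tail of dimension
  \<open>r\<close> and of \<open>t\<close> elements of its span, which has
  \<open>CARD('k) ^ r\<close> elements.\<close>

lemma card_span_tail:
  "card {c \<in> vectors (t + N). span (c ` {t..<t + N}) = span (c ` {..<t + N}) \<and> dim (c ` {..<t + N}) = r}
    = CARD('k) ^ (r * t) * card_of_dim N r"
proof -
  let ?A = "{c \<in> vectors (t + N). span (c ` {t..<t + N}) = span (c ` {..<t + N}) \<and> dim (c ` {..<t + N}) = r}"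
  let ?B = "SIGMA c:{c \<in> vectors N. dim (c ` {..<N}) = r}. {..<t} \<rightarrow>\<^sub>E span (c ` {..<N})"
  let ?join = "\<lambda>(c, b). \<lambda>i\<in>{..<t + N}. if i < t then b i else c (i - t)"
  let ?split = "\<lambda>c. (\<lambda>i\<in>{..<N}. c (t + i), restrict c {..<t})"
  have tail: "c ` {t..<t + N} = (\<lambda>i. c (t + i)) ` {..<N}" for c :: "nat \<Rightarrow> 'v"
  proof -
    have "{t..<t + N} = (+) t ` {..<N}" by (auto simp: nat_le_iff_add image_iff)
    then show ?thesis by (simp only: image_image)
  qed
  have whole: "c ` {..<t + N} = c ` {..<t} \<union> c ` {t..<t + N}" for c :: "nat \<Rightarrow> 'v"
    by (simp add: ivl_disj_un lessThan_atLeast0 flip: image_Un)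
  have span_iff: "span (c ` {t..<t + N}) = span (c ` {..<t + N}) \<longleftrightarrow> c ` {..<t} \<subseteq> span (c ` {t..<t + N})"
    for c :: "nat \<Rightarrow> 'v"
    unfolding whole span_eq
    using span_superset[of "c ` {t..<t + N}"] span_superset[of "c ` {..<t} \<union> c ` {t..<t + N}"] by blast
  \<comment> \<open>Equal spans have equal dimension, so the rank condition moves from the whole
    family to its tail, where \<open>?B\<close> imposes it.\<close>
  have A_iff: "c \<in> ?A \<longleftrightarrow> c \<in> vectors (t + N) \<and> c ` {..<t} \<subseteq> span ((\<lambda>i. c (t + i)) ` {..<N})
      \<and> dim ((\<lambda>i. c (t + i)) ` {..<N}) = r" for c
    using span_iff[of c] dim_span[of "c ` {..<t + N}"] dim_span[of "c ` {t..<t + N}"]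
    unfolding mem_Collect_eq tail by metis
  have "bij_betw ?split ?A ?B"
  proof (rule bij_betw_byWitness[where f' = ?join])
    show "\<forall>c\<in>?A. ?join (?split c) = c"
      by (auto simp: vectors_def fun_eq_iff PiE_iff extensional_def)
    show "\<forall>x\<in>?B. ?split (?join x) = x"
      by (auto simp: vectors_def fun_eq_iff PiE_iff extensional_def)
    show "?split ` ?A \<subseteq> ?B"
      unfolding image_subset_iff Ball_def A_iff by (auto simp: vectors_def)
    show "?join ` ?B \<subseteq> ?A"
    proof (rule image_subsetI)
      fix x assume "x \<in> ?B"
      then obtain c b where x: "x = (c, b)" "c \<in> vectors N" "dim (c ` {..<N}) = r"
        "b \<in> {..<t} \<rightarrow>\<^sub>E span (c ` {..<N})" by blast
      have 1: "(\<lambda>i. ?join x (t + i)) ` {..<N} = c ` {..<N}" using x by auto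
      have 2: "?join x ` {..<t} = b ` {..<t}" using x by auto
      have 3: "?join x \<in> vectors (t + N)" by (auto simp: vectors_def x)
      show "?join x \<in> ?A" unfolding A_iff 1 2 using 3 x by auto
    qed
  qed
  then have "card ?A = card ?B" by (rule bij_betw_same_card)
  also have "\<dots> = (\<Sum>c\<in>{c \<in> vectors N. dim (c ` {..<N}) = r}. card ({..<t} \<rightarrow>\<^sub>E span (c ` {..<N})))"
    by (rule card_SigmaI) (auto simp: finite_vectors finite_PiE)
  also have "\<dots> = (\<Sum>c\<in>{c \<in> vectors N. dim (c ` {..<N}) = r}. CARD('k) ^ (r * t))"
    by (intro sum.cong) (auto simp: card_PiE card_span power_mult)
  finally show ?thesis by (simp add: card_of_dim_def)
qed

text \<open>The factor \<open>falling_q_power Q m r / falling_q_power Q r r\<close> of both counts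
  does not depend on the length and is nonzero for \<open>r \<le> m\<close>, so it cancels.\<close>

lemma cond_prob_span_tail:
  assumes "CARD('v) = CARD('k) ^ m" "r \<le> m" "r \<le> t + N"
  defines "Q \<equiv> real CARD('k)"
  shows "real (card {c \<in> vectors (t + N). span (c ` {t..<t + N}) = span (c ` {..<t + N}) \<and> dim (c ` {..<t + N}) = r})
      / real (card {c \<in> vectors (t + N). dim (c ` {..<t + N}) = r})
    = Q ^ (r * t) * (\<Prod>i<r. (Q ^ N - Q ^ i) / (Q ^ (t + N) - Q ^ i))"
proof -
  have "CARD('k) > 1" using card_mono[of "UNIV :: 'k set" "{0, 1}"] by simp
  then have "Q > 1" by (simp add: Q_def)
  then have nz: "falling_q_power Q m r \<noteq> 0" "falling_q_power Q r r \<noteq> 0"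
    "falling_q_power Q (t + N) r \<noteq> 0"
    using assms(2,3) by (simp_all add: falling_q_power_nonzero)
  have count: "real (card_of_dim M r) = falling_q_power Q M r * falling_q_power Q m r / falling_q_power Q r r" for M
    unfolding Q_def by (rule card_of_dim_eq[OF assms(1)])
  have "real (CARD('k) ^ (r * t) * card_of_dim N r) / real (card_of_dim (t + N) r)
      = Q ^ (r * t) * (falling_q_power Q N r / falling_q_power Q (t + N) r)"
    unfolding of_nat_mult count of_nat_power Q_def[symmetric] using nz by simp
  then show ?thesis
    unfolding card_span_tail card_of_dim_def[symmetric] prod_dividef falling_q_power_def .
qed

end

section \<open>Supports of the lift\<close>

text \<open>Coefficients outside \<open>I\<close> contribute only the zero vector to the spanning
  set.\<close>

lemma lin_support_eq_span:
  assumes "field_embedding emb" "\<And>i. i \<notin> I \<Longrightarrow> lin_coeff q p i = 0"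
  shows "lin_support q emb p = module.span (\<lambda>c x. emb c * x) (lin_coeff q p ` I)"
proof -
  interpret vector_space "\<lambda>c x. emb c * x" by (rule vector_space_field_embedding[OF assms(1)])
  have "span (range (lin_coeff q p)) \<subseteq> span (insert 0 (lin_coeff q p ` I))"
    by (rule span_mono) (use assms(2) in blast)
  moreover have "span (lin_coeff q p ` I) \<subseteq> span (range (lin_coeff q p))"
    by (rule span_mono) blast
  ultimately show ?thesis unfolding lin_support_def by simp
qed

lemma cond_prob_pmf_of_set:
  assumes "finite S" "S \<noteq> {}"
  shows "\<P>(x in measure_pmf (pmf_of_set S). P x \<bar> Q x)
    = real (card {x\<in>S. P x \<and> Q x}) / real (card {x\<in>S. Q x})"
  using assms by (simp add: cond_prob_def measure_pmf_of_set Int_def)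

theorem proposition21:
  fixes emb :: "'k::{field,finite} \<Rightarrow> 'a::{field,finite}"
    and q m s n k \<alpha> r :: nat
    and f :: "nat \<Rightarrow> 'a poly"
    and d :: "nat \<Rightarrow> nat"
  defines "E \<equiv> \<lambda>e :: nat \<Rightarrow> 'a. crt_lift q s f (vector_block q d e)"
  assumes "primepow q" and "m \<ge> 1"
    and "CARD('k) = q" and "CARD('a) = q ^ m" and "field_embedding emb"
    and "\<And>i. i < s \<Longrightarrow> f i \<in> lin_polys_over q emb"
    and "\<And>i. i < s \<Longrightarrow> f i \<noteq> 0"
    and "\<And>i. i < s \<Longrightarrow> qdegree q (f i) = d i"
    and "n = (\<Sum>i<s. d i)"
    and "\<And>i. i < s \<Longrightarrow> lin_coprime q (f i) (other_llcm q s f i)"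
    and "0 < k" and "k < n" and "k + \<alpha> < n"
    and "r \<in> {1..min m (n - \<alpha> - k)}"
  shows "\<P>(e in measure_pmf (pmf_of_set (vectors n)).
            lin_support q emb (upper_part q (k + \<alpha>) n (E e)) = lin_support q emb (E e)
            \<bar> rank_weight q emb (E e) = r)
         = real q ^ (r * (k + \<alpha>)) *
           (\<Prod>i<r. (real q ^ (n - (k + \<alpha>)) - real q ^ i) / (real q ^ n - real q ^ i))"
proof -
  interpret finite_linearized_polynomials q "TYPE('a)"
    using assms(2,5) by (rule finite_linearized_polynomialsI)
  interpret V: finite_vector_space "\<lambda>c x. emb c * x"
    by (intro finite_vector_space.intro vector_space_field_embedding assms(6))
  let ?t = "k + \<alpha>"
  let ?c = "\<lambda>e. restrict (lin_coeff q (E e)) {..<n}"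
  define N where "N = n - ?t"
  have n: "n = ?t + N" using assms(14) by (simp add: N_def)
  have f_lin: "f i \<in> lins" if "i < s" for i using assms(7)[OF that] by (simp add: lin_polys_over_def)
  have bij: "bij_betw ?c (vectors n) (vectors n)"
    unfolding E_def assms(10) by (rule bij_betw_crt_lift) (use f_lin assms in auto)
  have E: "E e \<in> lin_polys_less q n" for e
    unfolding E_def assms(10) using crt_lift(1)[of s f "vector_block q d e"] f_lin assms(8,9,11) lin_of_less
    by (auto simp: vector_block_eq lin_polys_less_iff)
  have support: "lin_support q emb (E e) = V.span (?c e ` {..<n})" for e
    by (subst lin_support_eq_span[OF assms(6), of "{..<n}"]) (simp_all add: lin_coeff_less[OF E])
  have upper: "lin_support q emb (upper_part q ?t n (E e)) = V.span (?c e ` {?t..<n})" for e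
  proof -
    have coeff: "lin_coeff q (upper_part q ?t n (E e)) i = (if i \<in> {?t..<n} then ?c e i else 0)" for i
      unfolding upper_part_def by (subst lin_coeff_sum_monom) auto
    show ?thesis
      by (subst lin_support_eq_span[OF assms(6), of "{?t..<n}"]) (auto simp: coeff)
  qed
  have rank: "rank_weight q emb (E e) = V.dim (?c e ` {..<n})" for e
    unfolding rank_weight_def support by simp
  \<comment> \<open>Uniformity of the coefficient vector: as \<open>?c\<close> permutes
    \<open>vectors n\<close>, an event has as many preimages as elements.\<close>
  have transfer: "card {e \<in> vectors n. P (?c e)} = card {c \<in> vectors n. P c}" for P :: "(nat \<Rightarrow> 'a) \<Rightarrow> bool"
    by (rule bij_betw_same_card[OF bij_betw_Collect[OF bij]]) simp
  have nonempty: "vectors n \<noteq> ({} :: (nat \<Rightarrow> 'a) set)"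
    by (simp add: vectors_def PiE_eq_empty_iff)
  \<comment> \<open>The bound on \<open>r\<close> gives \<open>r \<le> m\<close> and
    \<open>r \<le> N\<close>, hence \<open>r \<le> ?t + N\<close>.\<close>
  have "real (card {c \<in> vectors n. V.span (c ` {?t..<n}) = V.span (c ` {..<n}) \<and> V.dim (c ` {..<n}) = r})
      / real (card {c \<in> vectors n. V.dim (c ` {..<n}) = r})
    = real q ^ (r * ?t) * (\<Prod>i<r. (real q ^ N - real q ^ i) / (real q ^ n - real q ^ i))"
    using V.cond_prob_span_tail[of m r ?t N] assms(4,5,15) n by auto
  then show ?thesis
    unfolding support upper rank cond_prob_pmf_of_set[OF finite_vectors nonempty]
      transfer[of "\<lambda>c. V.span (c ` {?t..<n}) = V.span (c ` {..<n}) \<and> V.dim (c ` {..<n}) = r"]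
      transfer[of "\<lambda>c. V.dim (c ` {..<n}) = r"] N_def[symmetric] .
qed

end
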